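(* For every integer $n\ge 18$, there exist families $\mathcal{B},\mathcal{R}\subset\mathcal{Q}_{n+2}$ with $\mathcal{B}\cap\mathcal{R}=\emptyset$ and $\mathcal{B}\cup\mathcal{R}=\mathcal{Q}_{n+2}$ such that $\mathcal{Q}_2$ is not an induced subposet of $\mathcal{B}$ and $\mathcal{Q}_n$ is not an induced subposet of $\mathcal{R}$ (where $\mathcal{B}$ and $\mathcal{R}$ are ordered by inclusion).
   Context: For a positive integer $N$, the Boolean lattice $\mathcal{Q}_N$ is the power set of $[N]=\{1,\dots,N\}$ ordered by inclusion. For posets $P$ and $Q$, $P$ is an induced subposet of $Q$ if there is an injection $f:P\to Q$ such that $f(x)\le f(y)$ holds if and only if $x\le y$. *)

theory Defs
  imports "HOL-Library.FuncSet"
begin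

text \<open>
  A poset is represented by its carrier, a set of elements of a type of class \<open>order\<close>, with the
  order inherited from that type. On \<open>nat set\<close> this order is inclusion, so every family of
  sets is ordered by inclusion.
\<close>

definition boolean_lattice :: "nat \<Rightarrow> nat set set" where
  "boolean_lattice N = Pow {1..N}"

definition induced_subposet :: "'a::order set \<Rightarrow> 'b::order set \<Rightarrow> bool" where
  "induced_subposet P Q \<longleftrightarrow>
     (\<exists>f. f \<in> P \<rightarrow> Q \<and> inj_on f P \<and> (\<forall>x\<in>P. \<forall>y\<in>P. f x \<le> f y \<longleftrightarrow> x \<le> y))"

end

theory Submission
  imports Defs
begin

text \<open>
  An induced copy \<open>f\<close> of \<open>\<Q>\<^sub>n\<close> in \<open>\<Q>\<^sub>n\<^sub>+\<^sub>2\<close> is, after relabelling, of the form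
  \<open>f S = S \<union> g S\<close> with \<open>g\<close> monotone and \<open>g S \<subseteq> {a, b}\<close>, where \<open>a, b\<close> are the two remaining points. It
  must therefore meet every family containing, for these two points, a set \<open>Z\<close> avoiding both, and above
  \<open>Z\<close> two chains which pick up \<open>a\<close> before \<open>b\<close> and \<open>b\<close> before \<open>a\<close>, respectively. A shrub with root \<open>A\<close>
  consisting of two long chains that add the elements of \<open>E\<close> in increasing and in decreasing order
  serves all pairs in \<open>E\<close> at once. Marker points \<open>c\<close> and \<open>d\<close>, one for each chain, keep the chains
  incomparable, so that the shrub contains no \<open>\<Q>\<^sub>2\<close>.

  To serve all pairs of points, label the points by the ordered pairs \<open>(k, l)\<close> of distinct elements of
  a 5-element set, using all 20 labels (hence \<open>n + 2 \<ge> 20\<close>). For each 2-subset \<open>P\<close> take a shrub whose root consists of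
  the points with \<open>k \<notin> P\<close>, \<open>l \<in> P\<close> and whose \<open>E\<close> consists of the points with \<open>k \<in> P\<close>; its
  markers have \<open>k, l \<notin> P\<close>. Any other root contains at least two points with \<open>k, l \<notin> P\<close>, so that elements of different shrubs are incomparable.
\<close>

section \<open>Shrubs, and diamond-free unions of them\<close>

definition shrub :: "'a::linorder set \<Rightarrow> 'a set \<Rightarrow> 'a \<Rightarrow> 'a \<Rightarrow> 'a set set" where
  "shrub A E c d = insert A (range (\<lambda>t. insert c (A \<union> (E \<inter> {..t}))) \<union> range (\<lambda>t. insert d (A \<union> (E \<inter> {t..}))))"

lemma shrub_root_subset: "X \<in> shrub A E c d \<Longrightarrow> A \<subseteq> X"
  by (auto simp: shrub_def)

lemma shrub_upper_bound:
  "X \<in> shrub A E c d \<Longrightarrow> X \<subseteq> insert c (A \<union> E) \<or> X \<subseteq> insert d (A \<union> E)"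
  by (auto simp: shrub_def)

text \<open>No member contains both markers, so \<open>Z\<close> and everything below it miss
  \<open>c\<close> or \<open>d\<close>. What remains is the root followed by a single chain.\<close>

lemma shrub_down_sets_are_chains:
  assumes "c \<noteq> d" "c \<notin> A \<union> E" "d \<notin> A \<union> E"
    and "X \<in> shrub A E c d" "Y \<in> shrub A E c d" "Z \<in> shrub A E c d" "X \<subseteq> Z" "Y \<subseteq> Z"
  shows "X \<subseteq> Y \<or> Y \<subseteq> X"
proof -
  define U where "U t = insert c (A \<union> (E \<inter> {..t}))" for t
  define D where "D t = insert d (A \<union> (E \<inter> {t..}))" for t
  have S: "W = A \<or> (\<exists>t. W = U t) \<or> (\<exists>t. W = D t)" if "W \<in> shrub A E c d" for W
    using that by (auto simp: shrub_def U_def D_def)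
  have A: "A \<subseteq> X" "A \<subseteq> Y"
    using assms shrub_root_subset by blast+
  have UU: "U s \<subseteq> U t \<or> U t \<subseteq> U s" for s t
    unfolding U_def using linear[of s t] by fastforce
  have DD: "D s \<subseteq> D t \<or> D t \<subseteq> D s" for s t
    unfolding D_def using linear[of s t] by fastforce
  have mem: "c \<in> U t" "d \<in> D t" "d \<notin> U t" "c \<notin> D t" "c \<notin> A" "d \<notin> A" for t
    using assms(1-3) by (auto simp: U_def D_def)
  consider "c \<notin> Z" | "d \<notin> Z"
    using S[OF assms(6)] mem by blast
  then show ?thesis
  proof cases
    case 1
    then have "X = A \<or> (\<exists>t. X = D t)" "Y = A \<or> (\<exists>t. Y = D t)"
      using S assms(4,5,7,8) mem by blast+
    then show ?thesis using A DD by metis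
  next
    case 2
    then have "X = A \<or> (\<exists>t. X = U t)" "Y = A \<or> (\<exists>t. Y = U t)"
      using S assms(4,5,7,8) mem by blast+
    then show ?thesis using A UU by metis
  qed
qed

lemma induced_Q2_diamond:
  assumes "induced_subposet (boolean_lattice 2) (\<F> :: 'a set set)"
  obtains W X Y Z where "W \<in> \<F>" "X \<in> \<F>" "Y \<in> \<F>" "Z \<in> \<F>" "W \<subseteq> X" "W \<subseteq> Y" "X \<subseteq> Z" "Y \<subseteq> Z"
    "\<not> X \<subseteq> Y" "\<not> Y \<subseteq> X"
proof -
  obtain f where f: "f \<in> Pow {1..2::nat} \<rightarrow> \<F>"
    and le: "\<And>x y. x \<subseteq> {1..2} \<Longrightarrow> y \<subseteq> {1..2} \<Longrightarrow> f x \<subseteq> f y \<longleftrightarrow> x \<subseteq> y"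
    using assms unfolding induced_subposet_def boolean_lattice_def by auto
  show thesis
    by (rule that[of "f {}" "f {1}" "f {2}" "f {1,2}"]) (use f in \<open>auto simp: le Pi_iff\<close>)
qed

text \<open>An inclusion between members of different shrubs would put the root of the lower one
  inside an upper bound of the other, against \<open>sep\<close>. So the middle elements of a
  diamond lie in the shrub of its top, where they are comparable.\<close>

lemma union_of_shrubs_Q2_free:
  assumes c: "\<And>i. i \<in> I \<Longrightarrow> c i \<noteq> d i \<and> c i \<notin> A i \<union> E i \<and> d i \<notin> A i \<union> E i"
    and sep: "\<And>i j. i \<in> I \<Longrightarrow> j \<in> I \<Longrightarrow> i \<noteq> j \<Longrightarrow>
      \<not> A j \<subseteq> insert (c i) (A i \<union> E i) \<and> \<not> A j \<subseteq> insert (d i) (A i \<union> E i)"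
  shows "\<not> induced_subposet (boolean_lattice 2) (\<Union>i\<in>I. shrub (A i) (E i) (c i) (d i))"
proof
  let ?T = "\<lambda>i. shrub (A i) (E i) (c i) (d i)"
  assume "induced_subposet (boolean_lattice 2) (\<Union>i\<in>I. ?T i)"
  then obtain X Y Z where XYZ: "X \<in> (\<Union>i\<in>I. ?T i)" "Y \<in> (\<Union>i\<in>I. ?T i)" "Z \<in> (\<Union>i\<in>I. ?T i)"
    "X \<subseteq> Z" "Y \<subseteq> Z" "\<not> X \<subseteq> Y" "\<not> Y \<subseteq> X"
    by (elim induced_Q2_diamond) blast
  have same: "i = j" if "i \<in> I" "j \<in> I" "V \<in> ?T i" "W \<in> ?T j" "W \<subseteq> V" for i j V W
    using shrub_root_subset[OF that(4)] shrub_upper_bound[OF that(3)] sep[OF that(1,2)] that(5)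
    by blast
  obtain i where i: "i \<in> I" "Z \<in> ?T i"
    using XYZ by blast
  with same XYZ have XY: "X \<in> ?T i" "Y \<in> ?T i"
    by blast+
  show False
    using shrub_down_sets_are_chains[OF _ _ _ XY i(2) XYZ(4,5)] c[OF i(1)] XYZ(6,7) by blast
qed

section \<open>Induced copies of a Boolean lattice and how to block them\<close>

lemma induced_copy_trace:
  assumes "induced_subposet (boolean_lattice n) \<F>"
  obtains f x where "f \<in> Pow {1..n} \<rightarrow> \<F>" "mono_on (Pow {1..n}) f"
    "inj_on x {1..n}" "\<forall>S\<in>Pow {1..n}. \<forall>i\<in>{1..n}. x i \<in> f S \<longleftrightarrow> i \<in> S"
proof -
  obtain f where f: "f \<in> Pow {1..n} \<rightarrow> \<F>"
    and le: "\<And>S T. S \<subseteq> {1..n} \<Longrightarrow> T \<subseteq> {1..n} \<Longrightarrow> f S \<subseteq> f T \<longleftrightarrow> S \<subseteq> T"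
    using assms unfolding induced_subposet_def boolean_lattice_def by auto
  \<comment> \<open>Such a point can represent \<open>i\<close> throughout: \<open>f S\<close>
    contains \<open>f {i}\<close> if \<open>i\<close> is in \<open>S\<close>, and lies in
    \<open>f ({1..n} - {i})\<close> otherwise.\<close>
  have "\<exists>y. y \<in> f {i} \<and> y \<notin> f ({1..n} - {i})" if "i \<in> {1..n}" for i
    using le[of "{i}" "{1..n} - {i}"] that by auto
  then obtain x where x: "\<And>i. i \<in> {1..n} \<Longrightarrow> x i \<in> f {i} \<and> x i \<notin> f ({1..n} - {i})"
    by metis
  have trace: "x i \<in> f S \<longleftrightarrow> i \<in> S" if "S \<subseteq> {1..n}" "i \<in> {1..n}" for S i
  proof
    assume "i \<in> S"
    then show "x i \<in> f S" using le[of "{i}" S] x[OF that(2)] that by auto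
  next
    assume "x i \<in> f S"
    then show "i \<in> S" using le[of S "{1..n} - {i}"] x[OF that(2)] that(1) by blast
  qed
  have "inj_on x {1..n}"
  proof (rule inj_onI)
    fix i j assume "i \<in> {1..n}" "j \<in> {1..n}" "x i = x j"
    then show "i = j" using trace[of "{j}" i] trace[of "{j}" j] by simp
  qed
  moreover have "mono_on (Pow {1..n}) f"
    using le by (auto intro!: mono_onI)
  ultimately show thesis
    using that[OF f] trace by simp
qed

lemma blocking_family_Qn_free:
  fixes \<B> :: "nat set set"
  assumes \<B>: "\<B> \<subseteq> boolean_lattice (n + 2)"
    and block: "\<And>a b. a \<in> {1..n+2} \<Longrightarrow> b \<in> {1..n+2} \<Longrightarrow> a < b \<Longrightarrow>
      \<exists>Z Za Zab Zb Zba. {Z, Za, Zab, Zb, Zba} \<subseteq> \<B> \<and> Z \<subseteq> Za \<and> Za \<subseteq> Zab \<and> Z \<subseteq> Zb \<and> Zb \<subseteq> Zba \<and>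
        a \<notin> Z \<and> b \<notin> Z \<and> a \<in> Za \<and> b \<notin> Za \<and> a \<in> Zab \<and> b \<in> Zab \<and>
        b \<in> Zb \<and> a \<notin> Zb \<and> a \<in> Zba \<and> b \<in> Zba"
  shows "\<not> induced_subposet (boolean_lattice n) (boolean_lattice (n + 2) - \<B>)"
proof
  assume "induced_subposet (boolean_lattice n) (boolean_lattice (n + 2) - \<B>)"
  then obtain f x where f: "f \<in> Pow {1..n} \<rightarrow> boolean_lattice (n + 2) - \<B>"
    and mono: "mono_on (Pow {1..n}) f" and inj: "inj_on x {1..n}"
    and trace': "\<forall>S\<in>Pow {1..n}. \<forall>i\<in>{1..n}. x i \<in> f S \<longleftrightarrow> i \<in> S"
    by (rule induced_copy_trace)
  have trace: "x i \<in> f S \<longleftrightarrow> i \<in> S" if "S \<subseteq> {1..n}" "i \<in> {1..n}" for S i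
    using trace' that by blast
  have sub: "f S \<subseteq> {1..n+2}" and red: "f S \<notin> \<B>" if "S \<subseteq> {1..n}" for S
    using f that by (auto simp: Pi_iff boolean_lattice_def)
  have "x ` {1..n} \<subseteq> {1..n+2}"
    using sub[of "{1..n}"] trace[of "{1..n}"] by blast
  moreover have "card (x ` {1..n}) = n"
    using inj by (simp add: card_image)
  ultimately have "card ({1..n+2} - x ` {1..n}) = 2"
    by (subst card_Diff_subset) auto
  then obtain u v where "{1..n+2} - x ` {1..n} = {u, v}" "u \<noteq> v"
    by (auto simp: card_2_iff)
  then obtain a b where ab: "{1..n+2} - x ` {1..n} = {a, b}" "a < b"
    by (metis insert_commute neqE)
  from ab have "a \<in> {1..n+2}" "b \<in> {1..n+2}"
    by blast+
  from block[OF this ab(2)] obtain Z Za Zab Zb Zba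
    where Zs: "Z \<in> \<B>" "Za \<in> \<B>" "Zab \<in> \<B>" "Zb \<in> \<B>" "Zba \<in> \<B>"
      "Z \<subseteq> Za" "Za \<subseteq> Zab" "Z \<subseteq> Zb" "Zb \<subseteq> Zba"
      "a \<notin> Z" "b \<notin> Z" "a \<in> Za" "b \<notin> Za" "a \<in> Zab" "b \<in> Zab" "b \<in> Zb" "a \<notin> Zb" "a \<in> Zba" "b \<in> Zba"
    by auto
  \<comment> \<open>\<open>g W\<close> is the member of the copy that agrees with \<open>W\<close>
    on the image of \<open>x\<close>. If \<open>W\<close> is in \<open>\<B>\<close>, then
    \<open>g W\<close> is a different set, so the two differ at \<open>a\<close> or
    \<open>b\<close>.\<close>
  define g where "g W = f {i \<in> {1..n}. x i \<in> W}" for W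
  have g_mono: "g V \<subseteq> g W" if "V \<subseteq> W" for V W
    unfolding g_def using that by (intro mono_onD[OF mono]) auto
  have g_neq: "(a \<in> g W) \<noteq> (a \<in> W) \<or> (b \<in> g W) \<noteq> (b \<in> W)" if W: "W \<in> \<B>" for W
  proof (rule ccontr)
    assume "\<not> ?thesis"
    then have ab_eq: "a \<in> g W \<longleftrightarrow> a \<in> W" "b \<in> g W \<longleftrightarrow> b \<in> W" by auto
    have "y \<in> g W \<longleftrightarrow> y \<in> W" if "y \<in> {1..n+2}" for y
    proof (cases "y \<in> x ` {1..n}")
      case True
      then obtain i where i: "i \<in> {1..n}" "y = x i" by blast
      have "x i \<in> g W \<longleftrightarrow> i \<in> {i \<in> {1..n}. x i \<in> W}"
        unfolding g_def by (rule trace) (use i in auto)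
      then show ?thesis using i by simp
    next
      case False
      then have "y = a \<or> y = b" using that ab(1) by blast
      then show ?thesis using ab_eq by blast
    qed
    moreover have "g W \<subseteq> {1..n+2}"
      unfolding g_def by (rule sub) auto
    moreover have "W \<subseteq> {1..n+2}"
      using W \<B> unfolding boolean_lattice_def by blast
    ultimately have "g W = W" by blast
    moreover have "g W \<notin> \<B>" unfolding g_def by (rule red) auto
    ultimately show False using W by simp
  qed
  \<comment> \<open>\<open>g Z\<close> contains \<open>a\<close> or \<open>b\<close>. If it contains
    \<open>a\<close>, then so does \<open>g Za\<close>, which must therefore contain
    \<open>b\<close> as well; then \<open>g Zab\<close> agrees with \<open>Zab\<close> at both
    points. The other case is symmetric.\<close>
  show False
    using g_neq[OF Zs(1)] g_neq[OF Zs(2)] g_neq[OF Zs(3)] g_neq[OF Zs(4)] g_neq[OF Zs(5)]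
      g_mono[OF Zs(6)] g_mono[OF Zs(7)] g_mono[OF Zs(8)] g_mono[OF Zs(9)] Zs(10-)
    by blast
qed

lemma shrub_blocks_pair:
  assumes "a \<in> E" "b \<in> E" "a < b" "A \<inter> E = {}" "c \<notin> E" "d \<notin> E"
  shows "\<exists>Z Za Zab Zb Zba. {Z, Za, Zab, Zb, Zba} \<subseteq> shrub A E c d \<and>
    Z \<subseteq> Za \<and> Za \<subseteq> Zab \<and> Z \<subseteq> Zb \<and> Zb \<subseteq> Zba \<and>
    a \<notin> Z \<and> b \<notin> Z \<and> a \<in> Za \<and> b \<notin> Za \<and> a \<in> Zab \<and> b \<in> Zab \<and> b \<in> Zb \<and> a \<notin> Zb \<and> a \<in> Zba \<and> b \<in> Zba"
  \<comment> \<open>The increasing chain is cut at \<open>a\<close>, then \<open>b\<close>; the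
    decreasing one at \<open>b\<close>, then \<open>a\<close>.\<close>
  apply (rule exI[of _ A])
  apply (rule exI[of _ "insert c (A \<union> (E \<inter> {..a}))"])
  apply (rule exI[of _ "insert c (A \<union> (E \<inter> {..b}))"])
  apply (rule exI[of _ "insert d (A \<union> (E \<inter> {b..}))"])
  apply (rule exI[of _ "insert d (A \<union> (E \<inter> {a..}))"])
  using assms by (auto simp: shrub_def)

section \<open>Labels: ordered pairs from a 5-element set\<close>

lemma two_labels:
  fixes P Q :: "nat set"
  assumes "P \<subseteq> {..<5}" "Q \<subseteq> {..<5}" "card P = 2" "card Q = 2" "P \<noteq> Q"
  shows "card (({..<5} - (P \<union> Q)) \<times> (Q - P)) = 2"
proof -
  have fin: "finite P" "finite Q"
    using assms(3,4) card_ge_0_finite by force+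
  have un: "card (P \<union> Q) = 2 + card (Q - P)"
    using card_Un_disjoint[of P "Q - P"] fin assms(3) by auto
  have diff: "card ({..<5} - (P \<union> Q)) = 3 - card (Q - P)"
    using card_Diff_subset[of "P \<union> Q" "{..<5}"] fin assms un by simp
  have "card (Q - P) \<le> 2"
    using card_mono[of Q "Q - P"] fin assms(4) by simp
  moreover have "card (Q - P) \<noteq> 0"
    using card_subset_eq[of P Q] fin assms by auto
  ultimately have "card (Q - P) = 1 \<or> card (Q - P) = 2"
    by linarith
  \<comment> \<open>With m = \<open>card (Q - P)\<close> the product has m(3 - m) elements, which is
    2 in both cases.\<close>
  then show ?thesis
    using diff by (auto simp: card_cartesian_product)
qed

lemma exists_labelling:
  assumes "finite V" "20 \<le> card V"
  obtains h :: "'a \<Rightarrow> nat \<times> nat" where "h ` V = {(k, l). k < 5 \<and> l < 5 \<and> k \<noteq> l}"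
proof -
  define L where "L = {(k, l). k < 5 \<and> l < (5::nat) \<and> k \<noteq> l}"
  have L: "L = {..<5} \<times> {..<5} - (\<lambda>k. (k, k)) ` {..<5}"
    by (auto simp: L_def)
  have "card ((\<lambda>k::nat. (k, k)) ` {..<5}) = 5"
    by (simp add: card_image inj_on_def)
  then have "card L = 20"
    unfolding L by (subst card_Diff_subset) (auto simp: card_cartesian_product)
  moreover have "finite L"
    unfolding L by simp
  ultimately obtain j where j: "inj_on j L" "j ` L \<subseteq> V"
    using card_le_inj[of L V] assms by auto
  define h where "h y = (if y \<in> j ` L then the_inv_into L j y else (0, 1))" for y
  have "(0, 1) \<in> L"
    by (simp add: L_def)
  then have "h y \<in> L" for y
    unfolding h_def using the_inv_into_into[OF j(1)] by simp
  moreover have "z \<in> h ` V" if "z \<in> L" for z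
    using that j the_inv_into_f_f[OF j(1) that] by (intro image_eqI[of _ _ "j z"]) (auto simp: h_def)
  ultimately show thesis
    by (intro that[of h, folded L_def]) blast
qed

theorem theorem3:
  fixes n :: nat
  assumes "n \<ge> 18"
  shows "\<exists>\<B> \<R>. \<B> \<subseteq> boolean_lattice (n + 2) \<and> \<R> \<subseteq> boolean_lattice (n + 2) \<and>
           \<B> \<inter> \<R> = {} \<and> \<B> \<union> \<R> = boolean_lattice (n + 2) \<and>
           \<not> induced_subposet (boolean_lattice 2) \<B> \<and>
           \<not> induced_subposet (boolean_lattice n) \<R>"
proof -
  define V where "V = {1..n+2}"
  obtain h :: "nat \<Rightarrow> nat \<times> nat" where h: "h ` V = {(k, l). k < 5 \<and> l < 5 \<and> k \<noteq> l}"
    using exists_labelling[of V] assms unfolding V_def by auto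
  define I where "I = {P :: nat set. P \<subseteq> {..<5} \<and> card P = 2}"
  define A where "A P = {y \<in> V. fst (h y) \<notin> P \<and> snd (h y) \<in> P}" for P
  define E where "E P = {y \<in> V. fst (h y) \<in> P}" for P
  define C where "C P = {y \<in> V. fst (h y) \<notin> P \<and> snd (h y) \<notin> P}" for P
  \<comment> \<open>One of the two points may be the marker \<open>c P\<close> (or
    \<open>d P\<close>); the other keeps the root \<open>A Q\<close> out of the corresponding upper
    bound for \<open>P\<close>.\<close>
  have sep: "\<exists>y z. y \<in> A Q \<inter> C P \<and> z \<in> A Q \<inter> C P \<and> y \<noteq> z" if "P \<in> I" "Q \<in> I" "P \<noteq> Q" for P Q
  proof -
    obtain s t where st: "({..<5} - (P \<union> Q)) \<times> (Q - P) = {s, t}" "s \<noteq> t"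
      using two_labels[of P Q] \<open>P \<in> I\<close> \<open>Q \<in> I\<close> \<open>P \<noteq> Q\<close> unfolding I_def card_2_iff by auto
    have "\<exists>y \<in> A Q \<inter> C P. h y = r" if "r \<in> {s, t}" for r
    proof -
      have r: "r \<in> ({..<5} - (P \<union> Q)) \<times> (Q - P)" using that st(1) by simp
      then have "r \<in> h ` V" using \<open>Q \<in> I\<close> by (auto simp: h I_def)
      then obtain y where "y \<in> V" "h y = r" by auto
      with r show ?thesis
        by (intro bexI[of _ y]) (auto simp: A_def C_def mem_Times_iff)
    qed
    then show ?thesis using st(2) by (metis insertI1 insertI2)
  qed
  have "\<exists>y z. y \<in> C P \<and> z \<in> C P \<and> y \<noteq> z" if "P \<in> I" for P
  proof -
    \<comment> \<open>At least one of these two sets differs from \<open>P\<close>, and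
      \<open>sep\<close> then supplies two possible markers.\<close>
    have "{0, 1} \<in> I" "{0, 2} \<in> I" "{0, 1} \<noteq> {0, 2::nat}"
      by (auto simp: I_def doubleton_eq_iff)
    then have "\<exists>Q \<in> I. Q \<noteq> P"
      by metis
    then show ?thesis using sep[OF that] by blast
  qed
  then obtain c d where cd: "\<And>P. P \<in> I \<Longrightarrow> c P \<in> C P \<and> d P \<in> C P \<and> c P \<noteq> d P"
    by metis
  define \<B> where "\<B> = (\<Union>P\<in>I. shrub (A P) (E P) (c P) (d P))"
  have disj: "A P \<inter> E P = {}" "C P \<inter> (A P \<union> E P) = {}" for P
    by (auto simp: A_def E_def C_def)
  have "\<B> \<subseteq> Pow V"
  proof
    fix X assume "X \<in> \<B>"
    then obtain P where P: "P \<in> I" "X \<in> shrub (A P) (E P) (c P) (d P)"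
      by (auto simp: \<B>_def)
    have "A P \<subseteq> V" "E P \<subseteq> V" "C P \<subseteq> V"
      by (auto simp: A_def E_def C_def)
    then show "X \<in> Pow V"
      using shrub_upper_bound[OF P(2)] cd[OF P(1)] by blast
  qed
  then have sub: "\<B> \<subseteq> boolean_lattice (n + 2)"
    by (simp add: V_def boolean_lattice_def)
  moreover have "\<not> induced_subposet (boolean_lattice 2) \<B>"
    unfolding \<B>_def
  proof (rule union_of_shrubs_Q2_free)
    fix P assume "P \<in> I"
    then show "c P \<noteq> d P \<and> c P \<notin> A P \<union> E P \<and> d P \<notin> A P \<union> E P"
      using cd disj(2)[of P] by blast
  next
    fix P Q assume "P \<in> I" "Q \<in> I" "P \<noteq> Q"
    then show "\<not> A Q \<subseteq> insert (c P) (A P \<union> E P) \<and> \<not> A Q \<subseteq> insert (d P) (A P \<union> E P)"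
      using sep[of P Q] disj(2)[of P] by blast
  qed
  moreover have "\<not> induced_subposet (boolean_lattice n) (boolean_lattice (n + 2) - \<B>)"
  proof (rule blocking_family_Qn_free[OF sub])
    fix a b assume ab: "a \<in> {1..n+2}" "b \<in> {1..n+2}" "a < b"
    have less: "fst (h y) < 5" if "y \<in> V" for y
    proof -
      have "h y \<in> h ` V" using that by simp
      then show ?thesis unfolding h by auto
    qed
    obtain P where P: "P \<in> I" "fst (h a) \<in> P" "fst (h b) \<in> P"
    proof (cases "fst (h a) = fst (h b)")
      case True
      \<comment> \<open>Equal first labels need a second element to fill up a 2-subset.\<close>
      define m :: nat where "m = (if fst (h a) = 0 then 1 else 0)"
      show thesis
        by (rule that[of "{fst (h a), m}"]) (use True less[of a] ab in \<open>auto simp: I_def V_def m_def\<close>)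
    next
      case False
      show thesis
        by (rule that[of "{fst (h a), fst (h b)}"])
          (use False less[of a] less[of b] ab in \<open>auto simp: I_def V_def\<close>)
    qed
    have "c P \<notin> E P" "d P \<notin> E P"
      using cd[OF P(1)] disj(2)[of P] by blast+
    moreover have "a \<in> E P" "b \<in> E P"
      using P ab by (auto simp: E_def V_def)
    moreover have "shrub (A P) (E P) (c P) (d P) \<subseteq> \<B>"
      using P(1) by (auto simp: \<B>_def)
    ultimately show "\<exists>Z Za Zab Zb Zba. {Z, Za, Zab, Zb, Zba} \<subseteq> \<B> \<and>
        Z \<subseteq> Za \<and> Za \<subseteq> Zab \<and> Z \<subseteq> Zb \<and> Zb \<subseteq> Zba \<and>
        a \<notin> Z \<and> b \<notin> Z \<and> a \<in> Za \<and> b \<notin> Za \<and> a \<in> Zab \<and> b \<in> Zab \<and>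
        b \<in> Zb \<and> a \<notin> Zb \<and> a \<in> Zba \<and> b \<in> Zba"
      using shrub_blocks_pair[OF _ _ ab(3) disj(1), of P "c P" "d P"] by (meson subset_trans)
  qed
  ultimately show ?thesis
    by (intro exI[of _ \<B>] exI[of _ "boolean_lattice (n + 2) - \<B>"]) auto
qed

end
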